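(* Let $\theta:[a,b]\to\mathbb R$ be a function, $x_0\in[a,b]$, and let $\widetilde\theta_h(x_0)$ be any (de-biased) estimator of $\theta(x_0)$ based on a sample of size $n$, with tuning parameter $h$ (which may depend on $n$). Put $R_n(h,\theta):=\mathbb E[\widetilde\theta_h(x_0)]-\theta(x_0)$ and let $\sigma_n(h)>0$ be a normalizer. Consider the decomposition $$\frac{\widetilde\theta_h(x_0)-\theta(x_0)}{\sigma_n(h)}=\frac{\widetilde\theta_h(x_0)-\mathbb E[\widetilde\theta_h(x_0)]}{\sigma_n(h)}+\frac{\mathbb E[\widetilde\theta_h(x_0)]-\theta(x_0)}{\sigma_n(h)}=:Z_n+\frac{R_n(h,\theta)}{\sigma_n(h)} .$$ Suppose that $Z_n\sim\mathcal N(0,1)$ and that $R_n(h,\theta)/\sigma_n(h)\to0$ as $n\to\infty$. Then for every fixed $\alpha\in(0,1)$ there exists $N_\alpha\in\mathbb N$ such that for all $n\ge N_\alpha$ $$(1-\alpha)-\mathbb P_\theta\Big(\theta(x_0)\in\big[\widetilde\theta_h(x_0)- z_{1-\alpha/2}\sigma_n(h),\ \widetilde\theta_h(x_0)+ z_{1-\alpha/2}\sigma_n(h)\big]\Big)\ \ge\ \frac14\, z_{1-\alpha/2}\,\phi(z_{1-\alpha/2})\left(\frac{R_n(h,\theta)}{\sigma_n(h)}\right)^2 ,$$ where $z_{1-\alpha/2}$ and $\phi$ denote the $(1-\alpha/2)$-quantile and the density of the standard normal distribution.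
   Context: $\mathbb P_\theta$ denotes the law of the data when the true function is $\theta$. The tuning parameter $h$ is a deterministic sequence $h=h_n$ representing a generic smoothing parameter; $\sigma_n(h)$ is deterministic. *)

theory Defs
  imports "HOL-Probability.Probability"
begin

text \<open>
  Throughout, \<open>P n \<theta>\<close> is the law of a sample of size \<open>n\<close> when the true function is \<open>\<theta>\<close>.
  Its space and measurable sets may vary with \<open>n\<close>.  \<open>T n h\<close> is the estimator of \<open>\<theta> x0\<close>
  with tuning parameter \<open>h\<close>, a function of the sample.  Functions on \<open>[a,b]\<close> are represented
  by total functions, which enter only through \<open>P n \<theta>\<close> and \<open>\<theta> x0\<close>.
\<close>

definition bias ::
  "(nat \<Rightarrow> (real \<Rightarrow> real) \<Rightarrow> 'w measure) \<Rightarrow> (nat \<Rightarrow> 'h \<Rightarrow> 'w \<Rightarrow> real) \<Rightarrow> real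
    \<Rightarrow> nat \<Rightarrow> 'h \<Rightarrow> (real \<Rightarrow> real) \<Rightarrow> real"
  where "bias P T x0 n h \<theta> = (LINT w|P n \<theta>. T n h w) - \<theta> x0"

definition standardized ::
  "(nat \<Rightarrow> (real \<Rightarrow> real) \<Rightarrow> 'w measure) \<Rightarrow> (nat \<Rightarrow> 'h \<Rightarrow> 'w \<Rightarrow> real) \<Rightarrow> (nat \<Rightarrow> 'h \<Rightarrow> real)
    \<Rightarrow> nat \<Rightarrow> 'h \<Rightarrow> (real \<Rightarrow> real) \<Rightarrow> 'w \<Rightarrow> real"
  where "standardized P T \<sigma> n h \<theta> w = (T n h w - (LINT w'|P n \<theta>. T n h w')) / \<sigma> n h"

lemma decomposition:
  "(T n h w - \<theta> x0) / \<sigma> n h = standardized P T \<sigma> n h \<theta> w + bias P T x0 n h \<theta> / \<sigma> n h"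
  by (simp add: bias_def standardized_def diff_divide_distrib)

text \<open>The generalized inverse of the distribution function; meaningful for \<open>0 < p < 1\<close>.\<close>

definition quantile :: "real measure \<Rightarrow> real \<Rightarrow> real"
  where "quantile M p = Inf {x. p \<le> cdf M x}"

abbreviation std_normal_quantile :: "real \<Rightarrow> real"
  where "std_normal_quantile \<equiv> quantile std_normal_distribution"

definition conf_interval ::
  "(nat \<Rightarrow> 'h \<Rightarrow> 'w \<Rightarrow> real) \<Rightarrow> (nat \<Rightarrow> 'h \<Rightarrow> real) \<Rightarrow> real \<Rightarrow> nat \<Rightarrow> 'h \<Rightarrow> 'w \<Rightarrow> real set"
  where "conf_interval T \<sigma> \<alpha> n h w =
    {T n h w - std_normal_quantile (1 - \<alpha> / 2) * \<sigma> n h ..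
     T n h w + std_normal_quantile (1 - \<alpha> / 2) * \<sigma> n h}"

end

theory Submission
  imports Defs
begin

text \<open>
  Write \<open>\<Phi>\<close> and \<open>\<phi>\<close> for the standard normal distribution function and density,
  \<open>z\<close> for the quantile and \<open>r\<close> for the bias divided by the normalizer.  The interval covers
  the true value exactly when \<open>\<bar>Z + r\<bar> \<le> z\<close>, so by the symmetry of the normal law the
  coverage is \<open>\<Phi> (z - r) + \<Phi> (z + r) - 1\<close> (lemma \<open>coverage_probability\<close>), while the
  nominal level is \<open>2 * \<Phi> z - 1\<close>.  The coverage deficit is therefore the concavity defect
  \<open>2 * \<Phi> z - \<Phi> (z - r) - \<Phi> (z + r)\<close>.

  The defect is even in \<open>r\<close>, vanishes at \<open>0\<close>, and has derivative \<open>\<phi> (z - r) - \<phi> (z + r)\<close>.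
  Completing the square turns this derivative into \<open>2 * \<phi> z * exp (- r\<^sup>2 / 2) * sinh (z * r)\<close>,
  which for \<open>0 \<le> r \<le> 1\<close> is at least \<open>z * r * \<phi> z\<close>, because \<open>sinh x \<ge> x\<close> and
  \<open>exp (- 1 / 2) \<ge> 1 / 2\<close>.  Integrating gives a defect of at least \<open>1 / 2 * z * \<phi> z * r\<^sup>2\<close>
  whenever \<open>\<bar>r\<bar> \<le> 1\<close> (lemma \<open>std_normal_cdf_concavity_defect\<close>).  This range of \<open>r\<close> does not
  depend on the level, so the index beyond which the bound holds can be chosen uniformly
  in \<open>\<alpha>\<close>, and the constant \<open>1 / 2\<close> may replace \<open>1 / 4\<close>.
\<close>

section \<open>Distribution functions of measures with a continuous density\<close>

lemma cdf_diff_density: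
  fixes f :: "real \<Rightarrow> real"
  assumes fin: "finite_borel_measure (density lborel f)"
    and f: "f \<in> borel_measurable borel" "\<And>x. 0 \<le> f x"
    and "c \<le> u"
  shows "cdf (density lborel f) u - cdf (density lborel f) c = (LBINT y=c..u. f y)"
proof (cases "c = u")
  case False
  interpret finite_borel_measure "density lborel f" by (fact fin)
  have "cdf (density lborel f) u - cdf (density lborel f) c = measure (density lborel f) {c<..u}"
    using False \<open>c \<le> u\<close> by (intro cdf_diff_eq) simp
  also have "\<dots> = (LINT y|density lborel f. indicator {c<..u} y)"
    by simp
  also have "\<dots> = (LBINT y:{c<..u}. f y)"
    using f unfolding set_lebesgue_integral_def
    by (subst integral_density) (auto simp: mult.commute)
  finally show ?thesis
    using \<open>c \<le> u\<close> by (simp add: interval_integral_Ioc)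
qed simp

text \<open>
  The fundamental theorem of calculus, applied on a bounded neighbourhood of \<open>x\<close>: basing the
  integral at \<open>x - 1\<close> keeps it proper.
\<close>

lemma cdf_has_derivative_density:
  fixes f :: "real \<Rightarrow> real"
  assumes fin: "finite_borel_measure (density lborel f)"
    and cont: "continuous_on UNIV f" and nonneg: "\<And>x. 0 \<le> f x"
  shows "(cdf (density lborel f) has_real_derivative f x) (at x)"
proof -
  have meas: "f \<in> borel_measurable borel"
    using cont by (rule borel_measurable_continuous_onI)
  have "((\<lambda>u. LBINT y=x-1..u. f y) has_vector_derivative f x) (at x within {x-1..x+1})"
    by (intro interval_integral_FTC2) (auto intro: continuous_on_subset[OF cont])
  then have "((\<lambda>u. LBINT y=x-1..u. f y) has_real_derivative f x) (at x within {x-1<..<x+1})"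
    unfolding has_real_derivative_iff_has_vector_derivative
    by (rule has_vector_derivative_within_subset) auto
  then have "((\<lambda>u. cdf (density lborel f) (x-1) + (LBINT y=x-1..u. f y))
      has_real_derivative f x) (at x within {x-1<..<x+1})"
    by (auto intro!: derivative_eq_intros)
  then have "(cdf (density lborel f) has_real_derivative f x) (at x within {x-1<..<x+1})"
  proof (rule has_field_derivative_transform_within[where d=1])
    fix u assume "u \<in> {x-1<..<x+1}"
    then show "cdf (density lborel f) (x-1) + (LBINT y=x-1..u. f y) = cdf (density lborel f) u"
      using cdf_diff_density[OF fin meas nonneg, of "x-1" u] by simp
  qed auto
  then show ?thesis
    by (simp add: at_within_open[of _ "{x-1<..<x+1}"])
qed

section \<open>The standard normal distribution function and its quantiles\<close>

interpretation std_normal: real_distribution std_normal_distribution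
  by (rule real_dist_normal_dist)

abbreviation std_normal_cdf :: "real \<Rightarrow> real" where
  "std_normal_cdf \<equiv> cdf std_normal_distribution"

lemma std_normal_cdf_has_derivative:
  "(std_normal_cdf has_real_derivative std_normal_density x) (at x)"
proof (rule cdf_has_derivative_density)
  show "continuous_on UNIV std_normal_density"
    unfolding std_normal_density_def[abs_def] by (intro continuous_intros) auto
qed (simp_all add: std_normal.finite_borel_measure_M)

lemmas std_normal_cdf_derivative_chain [derivative_intros] =
  DERIV_chain2[OF std_normal_cdf_has_derivative]

lemma isCont_std_normal_cdf: "isCont std_normal_cdf x"
  by (rule DERIV_isCont[OF std_normal_cdf_has_derivative])

lemma std_normal_cdf_strict_mono: "x < y \<Longrightarrow> std_normal_cdf x < std_normal_cdf y"
  by (rule DERIV_pos_imp_increasing)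
     (auto intro!: exI std_normal_cdf_has_derivative normal_density_pos)

lemma std_normal_density_minus: "std_normal_density (- x) = std_normal_density x"
  by (simp add: std_normal_density_def)

text \<open>
  As \<open>\<phi>\<close> is even, \<open>\<Phi> x + \<Phi> (- x)\<close> has derivative zero, and its limit at infinity
  identifies the constant.
\<close>

lemma std_normal_cdf_minus: "std_normal_cdf (- x) = 1 - std_normal_cdf x"
proof -
  have "((\<lambda>x. std_normal_cdf x + std_normal_cdf (- x)) has_real_derivative 0) (at x)" for x
    by (auto intro!: derivative_eq_intros simp: std_normal_density_minus)
  then have const: "std_normal_cdf y + std_normal_cdf (- y) = std_normal_cdf x + std_normal_cdf (- x)"
    for y by (intro DERIV_isconst_all[of "\<lambda>x. std_normal_cdf x + std_normal_cdf (- x)"] allI)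
  have "((\<lambda>y. std_normal_cdf y + std_normal_cdf (- y)) \<longlongrightarrow> 1 + 0) at_top"
    by (intro tendsto_add std_normal.cdf_lim_at_top_prob
      filterlim_compose[OF std_normal.cdf_lim_at_bot filterlim_uminus_at_bot_at_top])
  moreover have "((\<lambda>y. std_normal_cdf y + std_normal_cdf (- y))
      \<longlongrightarrow> std_normal_cdf x + std_normal_cdf (- x)) at_top"
    by (rule tendsto_eventually) (intro always_eventually allI const)
  ultimately have "1 + 0 = std_normal_cdf x + std_normal_cdf (- x)"
    by (rule tendsto_unique[OF trivial_limit_at_top_linorder])
  then show ?thesis by linarith
qed

lemma measure_std_normal_atLeastAtMost:
  assumes "c \<le> d"
  shows "measure std_normal_distribution {c..d} = std_normal_cdf d - std_normal_cdf c"
proof -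
  have atom: "measure std_normal_distribution {c} = 0"
    using isCont_std_normal_cdf std_normal.isCont_cdf by blast
  show ?thesis
  proof (cases "c = d")
    case True
    with atom show ?thesis by simp
  next
    case False
    then have "{c..d} = {c} \<union> {c<..d}" using assms by auto
    then have "measure std_normal_distribution {c..d} = measure std_normal_distribution {c<..d}"
      using atom by (simp add: std_normal.finite_measure_Union del: Un_insert_left)
    with False assms show ?thesis by (simp add: std_normal.cdf_diff_eq)
  qed
qed

lemma measure_std_normal_shifted:
  assumes "0 \<le> z"
  shows "measure std_normal_distribution {- z - r..z - r}
    = std_normal_cdf (z - r) + std_normal_cdf (z + r) - 1"
proof -
  have "std_normal_cdf (- z - r) = 1 - std_normal_cdf (z + r)"
    using std_normal_cdf_minus[of "z + r"] by (simp only: minus_add_distrib add_uminus_conv_diff)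
  then show ?thesis
    using assms by (subst measure_std_normal_atLeastAtMost) linarith+
qed

text \<open>
  Continuity makes \<open>\<Phi>\<close> attain every level \<open>p\<close> in \<open>(0, 1)\<close>; strict monotonicity turns the set
  in the generalized inverse into a closed half-line whose left endpoint is the point
  where \<open>p\<close> is attained.
\<close>

lemma std_normal_cdf_quantile:
  assumes "0 < p" "p < 1"
  shows "std_normal_cdf (std_normal_quantile p) = p"
proof -
  obtain l where l: "std_normal_cdf l < p"
    using order_tendstoD(2)[OF std_normal.cdf_lim_at_bot \<open>0 < p\<close>] by (auto simp: eventually_at_bot_linorder)
  obtain u where u: "p < std_normal_cdf u"
    using order_tendstoD(1)[OF std_normal.cdf_lim_at_top_prob \<open>p < 1\<close>] by (auto simp: eventually_at_top_linorder)
  have "l \<le> u"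
    using l u std_normal.cdf_nondecreasing[of u l] by (cases "l \<le> u") auto
  then obtain z where z: "std_normal_cdf z = p"
    using IVT[of std_normal_cdf l p u] l u isCont_std_normal_cdf by auto
  have "{x. p \<le> std_normal_cdf x} = {z..}"
    using z std_normal_cdf_strict_mono[of _ z] std_normal.cdf_nondecreasing[of z]
    by (auto simp: not_le[symmetric])
  then show ?thesis
    using z by (simp add: quantile_def)
qed

lemma std_normal_quantile_pos:
  assumes "1/2 < p" "p < 1"
  shows "0 < std_normal_quantile p"
proof (rule ccontr)
  assume "\<not> 0 < std_normal_quantile p"
  then have "p \<le> std_normal_cdf 0"
    using std_normal_cdf_quantile[of p] std_normal.cdf_nondecreasing[of "std_normal_quantile p" 0] assms by simp
  moreover have "std_normal_cdf 0 = 1/2"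
    using std_normal_cdf_minus[of 0] unfolding minus_zero by linarith
  ultimately show False using assms by simp
qed

section \<open>The concavity defect\<close>

lemma sinh_ge_self: "0 \<le> x \<Longrightarrow> x \<le> sinh (x::real)"
proof -
  assume "0 \<le> x"
  have "sinh 0 - 0 \<le> sinh x - x"
    by (rule DERIV_nonneg_imp_nondecreasing[OF \<open>0 \<le> x\<close>])
       (auto intro!: exI derivative_eq_intros simp: cosh_real_ge_1)
  then show ?thesis by simp
qed

text \<open>
  Completing the square separates the even factor in \<open>s\<close> from the exponential tilt.
\<close>

lemma std_normal_density_add:
  "std_normal_density (z + s) = std_normal_density z * exp (- s\<^sup>2 / 2) * exp (- (z * s))"
proof -
  have "- (z + s)\<^sup>2 / 2 = - z\<^sup>2 / 2 + - s\<^sup>2 / 2 + - (z * s)"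
    by (simp add: power2_eq_square field_simps)
  then show ?thesis
    unfolding std_normal_density_def by (simp only: exp_add mult.assoc)
qed

lemma std_normal_density_diff:
  "std_normal_density (z - s) - std_normal_density (z + s)
    = 2 * std_normal_density z * exp (- s\<^sup>2 / 2) * sinh (z * s)"
proof -
  have "std_normal_density (z - s) = std_normal_density z * exp (- s\<^sup>2 / 2) * exp (z * s)"
    using std_normal_density_add[of z "- s"] by simp
  moreover have "2 * sinh (z * s) = exp (z * s) - exp (- (z * s))"
    by (simp add: sinh_field_def)
  ultimately show ?thesis
    unfolding std_normal_density_add by algebra
qed

lemma std_normal_density_diff_ge:
  assumes "0 \<le> z" "0 \<le> s" "s \<le> 1"
  shows "z * s * std_normal_density z \<le> std_normal_density (z - s) - std_normal_density (z + s)"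
proof -
  have "s\<^sup>2 \<le> 1" using assms by (simp add: power_le_one)
  then have "1 / 2 \<le> exp (- s\<^sup>2 / 2)" using exp_ge_add_one_self[of "- s\<^sup>2 / 2"] by simp
  moreover have "z * s \<le> sinh (z * s)" using assms by (intro sinh_ge_self) simp
  ultimately have "1 / 2 * (z * s) \<le> exp (- s\<^sup>2 / 2) * sinh (z * s)"
    using assms by (intro mult_mono) auto
  then have "2 * std_normal_density z * (1 / 2 * (z * s)) \<le> 2 * std_normal_density z * (exp (- s\<^sup>2 / 2) * sinh (z * s))"
    by (intro mult_left_mono) auto
  then show ?thesis unfolding std_normal_density_diff by (simp add: mult_ac)
qed

text \<open>
  A quantitative form of the concavity of \<open>\<Phi>\<close> on the positive half-line.  The smaller point
  \<open>z - r\<close> or \<open>z + r\<close> may be negative, which does no harm: for positive \<open>z\<close> and \<open>s\<close> the point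
  \<open>z - s\<close> is nearer to \<open>0\<close> than \<open>z + s\<close>, so \<open>\<phi>\<close> is larger there.  Taylor expansion gives the
  defect as \<open>z * \<phi> z * r\<^sup>2\<close> to leading order; half of it is guaranteed
  for all \<open>\<bar>r\<bar> \<le> 1\<close>.
\<close>

lemma std_normal_cdf_concavity_defect:
  assumes z: "0 \<le> z" and r: "\<bar>r\<bar> \<le> 1"
  shows "1 / 2 * z * std_normal_density z * r\<^sup>2
    \<le> 2 * std_normal_cdf z - std_normal_cdf (z - r) - std_normal_cdf (z + r)"
proof -
  define G where "G s = 2 * std_normal_cdf z - std_normal_cdf (z - s) - std_normal_cdf (z + s)
      - 1 / 2 * z * std_normal_density z * s\<^sup>2" for s
  \<comment> \<open>\<open>G\<close> is even, so monotonicity on the nonnegative half-line suffices.\<close>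
  have "G 0 \<le> G \<bar>r\<bar>"
  proof (rule DERIV_nonneg_imp_nondecreasing[where f=G])
    fix s assume s: "0 \<le> s" "s \<le> \<bar>r\<bar>"
    have "(G has_real_derivative std_normal_density (z - s) - std_normal_density (z + s)
        - z * s * std_normal_density z) (at s)"
      unfolding G_def[abs_def] by (auto intro!: derivative_eq_intros)
    moreover have "0 \<le> std_normal_density (z - s) - std_normal_density (z + s)
        - z * s * std_normal_density z"
      using std_normal_density_diff_ge[of z s] s r z by simp
    ultimately show "\<exists>y. DERIV G s :> y \<and> 0 \<le> y" by (intro exI conjI)
  qed simp
  moreover have "G \<bar>r\<bar> = G r" by (simp add: G_def abs_if)
  ultimately show ?thesis by (simp add: G_def)
qed

section \<open>Coverage of the confidence interval\<close>

text \<open>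
  The interval has half-width \<open>z\<close> on the standardized scale, where the estimation error
  is the standard normal variable shifted by \<open>r\<close>.  Reflecting the lower endpoint puts
  the probability into the symmetric form whose difference to \<open>2 * \<Phi> z - 1\<close> is the
  concavity defect.
\<close>

lemma coverage_probability:
  assumes sigma: "0 < \<sigma> n h"
    and Z: "distributed (P n \<theta>) lborel (standardized P T \<sigma> n h \<theta>) std_normal_density"
    and z: "0 \<le> std_normal_quantile (1 - \<alpha> / 2)" (is "0 \<le> ?z")
  shows "measure (P n \<theta>) {w \<in> space (P n \<theta>). \<theta> x0 \<in> conf_interval T \<sigma> \<alpha> n h w}
    = std_normal_cdf (?z - bias P T x0 n h \<theta> / \<sigma> n h)
      + std_normal_cdf (?z + bias P T x0 n h \<theta> / \<sigma> n h) - 1"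
proof -
  let ?Z = "standardized P T \<sigma> n h \<theta>" and ?r = "bias P T x0 n h \<theta> / \<sigma> n h"
  have covered_iff: "\<theta> x0 \<in> conf_interval T \<sigma> \<alpha> n h w \<longleftrightarrow> ?Z w \<in> {- ?z - ?r..?z - ?r}" for w
  proof -
    have "\<theta> x0 \<in> conf_interval T \<sigma> \<alpha> n h w \<longleftrightarrow> (T n h w - \<theta> x0) / \<sigma> n h \<in> {- ?z..?z}"
      using sigma by (auto simp: conf_interval_def field_simps)
    then show ?thesis
      unfolding decomposition[of T n h w \<theta> x0 \<sigma> P] by auto
  qed
  have event: "{w \<in> space (P n \<theta>). \<theta> x0 \<in> conf_interval T \<sigma> \<alpha> n h w}
      = ?Z -` {- ?z - ?r..?z - ?r} \<inter> space (P n \<theta>)"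
    unfolding covered_iff by blast
  have "measure (P n \<theta>) {w \<in> space (P n \<theta>). \<theta> x0 \<in> conf_interval T \<sigma> \<alpha> n h w}
      = measure (distr (P n \<theta>) lborel ?Z) {- ?z - ?r..?z - ?r}"
    unfolding event by (rule measure_distr[symmetric]) (use distributed_measurable[OF Z] in auto)
  also have "\<dots> = std_normal_cdf (?z - ?r) + std_normal_cdf (?z + ?r) - 1"
    unfolding distributed_distr_eq_density[OF Z] by (rule measure_std_normal_shifted[OF z])
  finally show ?thesis .
qed

theorem proposition1:
  fixes a b x0 :: real
    and \<theta> :: "real \<Rightarrow> real"
    and P :: "nat \<Rightarrow> (real \<Rightarrow> real) \<Rightarrow> 'w measure"
    and T :: "nat \<Rightarrow> 'h \<Rightarrow> 'w \<Rightarrow> real"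
    and h :: "nat \<Rightarrow> 'h"
    and \<sigma> :: "nat \<Rightarrow> 'h \<Rightarrow> real"
  assumes x0: "x0 \<in> {a..b}"
    and law: "\<And>n. n \<ge> 1 \<Longrightarrow> prob_space (P n \<theta>)"
    and integrable: "\<And>n. n \<ge> 1 \<Longrightarrow> integrable (P n \<theta>) (T n (h n))"
    and sigma_pos: "\<And>n. n \<ge> 1 \<Longrightarrow> \<sigma> n (h n) > 0"
    and normal: "\<And>n. n \<ge> 1 \<Longrightarrow>
      distributed (P n \<theta>) lborel (standardized P T \<sigma> n (h n) \<theta>) std_normal_density"
    and bias_negligible: "(\<lambda>n. bias P T x0 n (h n) \<theta> / \<sigma> n (h n)) \<longlonglongrightarrow> 0"
  shows "\<forall>\<alpha>\<in>{0<..<1}. \<exists>N::nat. \<forall>n\<ge>N.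
    (1 - \<alpha>) - measure (P n \<theta>) {w \<in> space (P n \<theta>). \<theta> x0 \<in> conf_interval T \<sigma> \<alpha> n (h n) w}
      \<ge> 1 / 4 * std_normal_quantile (1 - \<alpha> / 2)
          * std_normal_density (std_normal_quantile (1 - \<alpha> / 2))
          * (bias P T x0 n (h n) \<theta> / \<sigma> n (h n))\<^sup>2"
proof
  fix \<alpha> :: real assume \<alpha>: "\<alpha> \<in> {0<..<1}"
  define z where "z = std_normal_quantile (1 - \<alpha> / 2)"
  define r where "r n = bias P T x0 n (h n) \<theta> / \<sigma> n (h n)" for n
  have "0 < z"
    unfolding z_def using \<alpha> by (intro std_normal_quantile_pos) auto
  have cdf_z: "std_normal_cdf z = 1 - \<alpha> / 2"
    unfolding z_def using \<alpha> by (intro std_normal_cdf_quantile) auto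
  obtain N where N: "\<bar>r n\<bar> \<le> 1" if "n \<ge> N" for n
    using LIMSEQ_D[OF bias_negligible, of 1] by (force simp: r_def intro: less_imp_le)
  show "\<exists>N::nat. \<forall>n\<ge>N.
    (1 - \<alpha>) - measure (P n \<theta>) {w \<in> space (P n \<theta>). \<theta> x0 \<in> conf_interval T \<sigma> \<alpha> n (h n) w}
      \<ge> 1 / 4 * std_normal_quantile (1 - \<alpha> / 2)
          * std_normal_density (std_normal_quantile (1 - \<alpha> / 2))
          * (bias P T x0 n (h n) \<theta> / \<sigma> n (h n))\<^sup>2"
    unfolding z_def[symmetric] r_def[symmetric]
  proof (intro exI allI impI)
    \<comment> \<open>The assumptions on the sample start at \<open>n = 1\<close>.\<close>
    fix n assume n: "max 1 N \<le> n"
    have coverage: "measure (P n \<theta>)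
        {w \<in> space (P n \<theta>). \<theta> x0 \<in> conf_interval T \<sigma> \<alpha> n (h n) w}
      = std_normal_cdf (z - r n) + std_normal_cdf (z + r n) - 1"
      using n \<open>0 < z\<close> unfolding z_def r_def
      by (intro coverage_probability sigma_pos normal) (simp_all only: max.bounded_iff less_imp_le)
    have "1 / 4 * z * std_normal_density z * (r n)\<^sup>2 \<le> 1 / 2 * z * std_normal_density z * (r n)\<^sup>2"
      using \<open>0 < z\<close> by (intro mult_right_mono) auto
    also have "\<dots> \<le> 2 * std_normal_cdf z - std_normal_cdf (z - r n) - std_normal_cdf (z + r n)"
      using \<open>0 < z\<close> n N by (intro std_normal_cdf_concavity_defect) auto
    also have "\<dots> = (1 - \<alpha>)
        - measure (P n \<theta>) {w \<in> space (P n \<theta>). \<theta> x0 \<in> conf_interval T \<sigma> \<alpha> n (h n) w}"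
      unfolding coverage using cdf_z by linarith
    finally show "1 / 4 * z * std_normal_density z * (r n)\<^sup>2 \<le> (1 - \<alpha>)
        - measure (P n \<theta>) {w \<in> space (P n \<theta>). \<theta> x0 \<in> conf_interval T \<sigma> \<alpha> n (h n) w}" .
  qed
qed

end
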